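(* In $\mathcal F_{2,q}$ it holds that $$R_q^*=\mathrm I,$$ where $\mathrm I$ is the integration operator.
   Context: Here $q\in[0,1]$, $[n]_q=1+q+\cdots+q^{n-1}$ for $n\ge1$, $[0]_q!=1$ and $[n]_q!=[1]_q[2]_q\cdots[n]_q$. The space $\mathcal F_{2,q}$ is the reproducing kernel Hilbert space with reproducing kernel $\sum_{n=0}^\infty\frac{z^n\overline w^n}{([n]_q!)^2}$, i.e. the space of all functions $f(z)=\sum_{n\ge0}f_nz^n$ such that $\sum_{n\ge0}|f_n|^2([n]_q!)^2<\infty$, with $\langle z^n,z^m\rangle_{\mathcal F_{2,q}}=([n]_q!)^2\delta_{n,m}$. For $0\le q<1$, $R_qf(z)=\frac{f(z)-f(qz)}{(1-q)z}$, and $R_1=\partial$ is differentiation; $R_q^*$ is the adjoint of $R_q$ in $\mathcal F_{2,q}$. The integration operator is $(\mathrm If)(z)=\int_{[0,z]}f(s)\,ds$.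
   Formalization: For q<1 the claim fails with the ordinary integral (pair z² with z: 1+q versus (1+q)²/2), so I is taken there as the Jackson q-integral (1-q)z Σ q^k f(q^k z); for q=1 it is the ordinary integral over [0,z]. *)

theory Defs
  imports "HOL-Complex_Analysis.Complex_Analysis"
begin

definition q_number :: "real \<Rightarrow> nat \<Rightarrow> real" where
  "q_number q n = (\<Sum>k<n. q ^ k)"

definition q_fact :: "real \<Rightarrow> nat \<Rightarrow> real" where
  "q_fact q n = (\<Prod>k=1..n. q_number q k)"

text \<open>The set on which the kernel \<open>\<Sum>n. (z * cnj w) ^ n / (q_fact q n)\<^sup>2\<close> converges on the diagonal:
  the disc of radius \<open>1 / (1 - q)\<close> for \<open>0 \<le> q < 1\<close>, the whole plane for \<open>q = 1\<close>.\<close>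

definition F2q_domain :: "real \<Rightarrow> complex set" where
  "F2q_domain q = {z. (1 - q) * norm z < 1}"

text \<open>Functions on \<open>F2q_domain q\<close> are represented by total functions that are \<open>undefined\<close> outside it
  (\<open>extensional\<close>), so that equality in HOL is equality of functions on the domain.\<close>

definition F2q :: "real \<Rightarrow> (complex \<Rightarrow> complex) set" where
  "F2q q = {f \<in> extensional (F2q_domain q).
     \<exists>a. (\<forall>z\<in>F2q_domain q. (\<lambda>n. a n * z ^ n) sums f z) \<and>
         summable (\<lambda>n. (norm (a n))\<^sup>2 * (q_fact q n)\<^sup>2)}"

definition taylor_coeff :: "(complex \<Rightarrow> complex) \<Rightarrow> nat \<Rightarrow> complex" where
  "taylor_coeff f n = (deriv ^^ n) f 0 / fact n"

definition F2q_inner :: "real \<Rightarrow> (complex \<Rightarrow> complex) \<Rightarrow> (complex \<Rightarrow> complex) \<Rightarrow> complex" where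
  "F2q_inner q f g =
     (\<Sum>n. taylor_coeff f n * cnj (taylor_coeff g n) * complex_of_real ((q_fact q n)\<^sup>2))"

text \<open>At \<open>z = 0\<close> the difference quotient has a removable singularity, with value \<open>deriv f 0\<close>.\<close>

definition R_op :: "real \<Rightarrow> (complex \<Rightarrow> complex) \<Rightarrow> complex \<Rightarrow> complex" where
  "R_op q f = (\<lambda>z\<in>F2q_domain q.
     if q = 1 \<or> z = 0 then deriv f z
     else (f z - f (complex_of_real q * z)) / (complex_of_real (1 - q) * z))"

text \<open>The integral of \<open>f\<close> over the segment from \<open>0\<close> to \<open>z\<close> in the sense of q-calculus: the ordinary
  line integral for \<open>q = 1\<close>, and the Jackson integral, taken with respect to \<open>d\<^sub>q s\<close>, for
  \<open>0 \<le> q < 1\<close>. For \<open>q < 1\<close> the ordinary line integral is not the adjoint of \<open>R_op q\<close>: pairing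
  \<open>z\<^sup>2\<close> and \<open>z\<close> gives \<open>1 + q\<close> on one side and \<open>(1 + q)\<^sup>2 / 2\<close> on the other.\<close>

definition integration_op :: "real \<Rightarrow> (complex \<Rightarrow> complex) \<Rightarrow> complex \<Rightarrow> complex" where
  "integration_op q f = (\<lambda>z\<in>F2q_domain q.
     if q = 1 then contour_integral (linepath 0 z) f
     else complex_of_real (1 - q) * z *
       (\<Sum>k. complex_of_real q ^ k * f (complex_of_real q ^ k * z)))"

text \<open>The adjoint of an operator \<open>T\<close> on a space \<open>H\<close> with inner product \<open>ip\<close>; only its values on
  \<open>H\<close> are meaningful.\<close>

definition adjoint_on ::
  "'a set \<Rightarrow> ('a \<Rightarrow> 'a \<Rightarrow> complex) \<Rightarrow> ('a \<Rightarrow> 'a) \<Rightarrow> 'a \<Rightarrow> 'a" where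
  "adjoint_on H ip T g = (THE h. h \<in> H \<and> (\<forall>f\<in>H. ip (T f) g = ip f h))"

end

theory Submission
  imports Defs
begin

text \<open>In terms of Taylor coefficients, \<open>R_op q\<close> is the weighted backward shift
  \<open>a\<^sub>n \<mapsto> [n+1] a\<^sub>n\<^sub>+\<^sub>1\<close>, whose adjoint for the weights \<open>([n]!)\<^sup>2\<close> is the weighted forward shift
  \<open>b\<^sub>n \<mapsto> b\<^sub>n / [n+1]\<close> landing in degree \<open>n + 1\<close>. This forward shift sends \<open>g\<close> to the unique
  \<open>G\<close> with \<open>R_op q G = g\<close> and \<open>G 0 = 0\<close>, and \<open>G\<close> is the integral of \<open>g\<close>: by the fundamental theorem
  of calculus if \<open>q = 1\<close>, and by telescoping \<open>G (q\<^sup>k z) - G (q\<^sup>k\<^sup>+\<^sup>1 z)\<close> if \<open>q < 1\<close>.\<close>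

section \<open>The q-numbers and q-factorials\<close>

lemma q_number_ge_1:
  assumes "0 \<le> q"
  shows "q_number q (Suc n) \<ge> 1"
  unfolding q_number_def sum.lessThan_Suc_shift using assms by (simp add: sum_nonneg)

lemma q_number_pos:
  assumes "0 \<le> q"
  shows "q_number q (Suc n) > 0"
  using q_number_ge_1[OF assms, of n] by linarith

text \<open>The geometric sum, kept free of division so that it also covers
  \<open>q = 1\<close>.\<close>

lemma q_number_mult: "(1 - q) * q_number q n = 1 - q ^ n"
  unfolding q_number_def by (simp add: one_diff_power_eq)

lemma q_number_1: "q_number 1 n = real n"
  by (simp add: q_number_def)

lemma q_fact_Suc: "q_fact q (Suc n) = q_fact q n * q_number q (Suc n)"
  by (simp add: q_fact_def)

lemma q_fact_pos:
  assumes "0 \<le> q"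
  shows "q_fact q n > 0"
  unfolding q_fact_def
proof (rule prod_pos)
  fix k assume "k \<in> {1..n}"
  then show "0 < q_number q k"
    using q_number_pos[OF assms, of "k - 1"] by simp
qed

section \<open>The domain of convergence\<close>

lemma F2q_domain_zero: "0 \<in> F2q_domain q"
  by (simp add: F2q_domain_def)

lemma F2q_domain_1: "F2q_domain 1 = UNIV"
  by (simp add: F2q_domain_def)

lemma open_F2q_domain: "open (F2q_domain q)"
  unfolding F2q_domain_def by (intro open_Collect_less continuous_intros)

text \<open>Ensures that \<open>f\<close> is evaluated at \<open>q * z\<close> and
  \<open>q ^ k * z\<close> only inside the domain, where its power series represents it. The
  assumption \<open>q \<le> 1\<close> keeps the factor \<open>1 - q\<close> nonnegative.\<close>

lemma F2q_domain_mult: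
  assumes "z \<in> F2q_domain q" "norm w \<le> 1" "q \<le> 1"
  shows "w * z \<in> F2q_domain q"
proof -
  have "(1 - q) * norm (w * z) \<le> (1 - q) * norm z"
    using assms by (intro mult_left_mono) (auto simp: norm_mult mult_left_le_one_le)
  then show ?thesis
    using assms by (simp add: F2q_domain_def)
qed

section \<open>Power series and Taylor coefficients\<close>

text \<open>Convergence at one nonzero point of \<open>S\<close>, here \<open>e / 2\<close>, already
  forces a positive radius of convergence. The expansion then yields both the Taylor coefficients
  and continuity at 0.\<close>

lemma power_series_has_fps_expansion:
  fixes f :: "complex \<Rightarrow> complex"
  assumes "open S" "0 \<in> S" and sums: "\<And>z. z \<in> S \<Longrightarrow> (\<lambda>n. a n * z ^ n) sums f z"
  shows "f has_fps_expansion Abs_fps a"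
proof -
  obtain e where e: "e > 0" "ball 0 e \<subseteq> S"
    using assms(1,2) openE by blast
  have "complex_of_real (e / 2) \<in> S"
    using e by (intro subsetD[OF e(2)]) auto
  then have "summable (\<lambda>n. a n * complex_of_real (e / 2) ^ n)"
    using sums sums_summable by blast
  then have "conv_radius a \<ge> norm (complex_of_real (e / 2))"
    by (rule conv_radius_geI)
  then have "fps_conv_radius (Abs_fps a) \<ge> ereal (e / 2)"
    using e by (simp add: fps_conv_radius_def)
  then have "fps_conv_radius (Abs_fps a) > 0"
    using e(1) by (metis ereal_less(2) half_gt_zero order_less_le_trans)
  moreover have "\<forall>\<^sub>F z in nhds 0. z \<in> S"
    using assms(1,2) by (rule eventually_nhds_in_open)
  then have "\<forall>\<^sub>F z in nhds 0. eval_fps (Abs_fps a) z = f z"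
    by eventually_elim (use sums in \<open>auto simp: eval_fps_def sums_iff\<close>)
  ultimately show ?thesis
    by (simp add: has_fps_expansion_def)
qed

text \<open>Links the existentially quantified coefficients in \<open>F2q\<close> with the
  derivatives at 0 that enter \<open>F2q_inner\<close>.\<close>

lemma taylor_coeff_power_series:
  assumes "\<And>z. z \<in> F2q_domain q \<Longrightarrow> (\<lambda>n. a n * z ^ n) sums f z"
  shows "taylor_coeff f = a"
  unfolding taylor_coeff_def
  using fps_nth_fps_expansion[OF power_series_has_fps_expansion[OF open_F2q_domain F2q_domain_zero assms]]
  by fastforce

lemma F2qI:
  assumes "f \<in> extensional (F2q_domain q)"
    and "\<And>z. z \<in> F2q_domain q \<Longrightarrow> (\<lambda>n. a n * z ^ n) sums f z"
    and "summable (\<lambda>n. (norm (a n))\<^sup>2 * (q_fact q n)\<^sup>2)"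
  shows "f \<in> F2q q"
  using assms unfolding F2q_def by blast

lemma F2qD:
  assumes "f \<in> F2q q"
  shows "f \<in> extensional (F2q_domain q)"
    and "\<And>z. z \<in> F2q_domain q \<Longrightarrow> (\<lambda>n. taylor_coeff f n * z ^ n) sums f z"
    and "summable (\<lambda>n. (norm (taylor_coeff f n))\<^sup>2 * (q_fact q n)\<^sup>2)"
proof -
  obtain a where a: "\<And>z. z \<in> F2q_domain q \<Longrightarrow> (\<lambda>n. a n * z ^ n) sums f z"
      "summable (\<lambda>n. (norm (a n))\<^sup>2 * (q_fact q n)\<^sup>2)"
    and ext: "f \<in> extensional (F2q_domain q)"
    using assms unfolding F2q_def by auto
  have eq: "taylor_coeff f = a"
    using taylor_coeff_power_series a(1) .
  show "f \<in> extensional (F2q_domain q)"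
    and "\<And>z. z \<in> F2q_domain q \<Longrightarrow> (\<lambda>n. taylor_coeff f n * z ^ n) sums f z"
    and "summable (\<lambda>n. (norm (taylor_coeff f n))\<^sup>2 * (q_fact q n)\<^sup>2)"
    using a ext unfolding eq by auto
qed

lemma F2q_eqI:
  assumes "f \<in> F2q q" "g \<in> F2q q" "taylor_coeff f = taylor_coeff g"
  shows "f = g"
proof (rule extensionalityI[OF F2qD(1)[OF assms(1)] F2qD(1)[OF assms(2)]])
  fix z assume "z \<in> F2q_domain q"
  then show "f z = g z"
    using F2qD(2)[OF assms(1)] F2qD(2)[OF assms(2)] sums_unique2 unfolding assms(3) by blast
qed

section \<open>The operator \<open>R_op\<close> on coefficients\<close>

lemma entire_power_series_deriv:
  fixes f :: "complex \<Rightarrow> complex"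
  assumes "\<And>z. (\<lambda>n. a n * z ^ n) sums f z"
  shows "(f has_field_derivative deriv f z) (at z)"
    and "(\<lambda>n. of_nat (Suc n) * a (Suc n) * z ^ n) sums deriv f z"
proof -
  have summable: "summable (\<lambda>n. a n * w ^ n)" for w
    using assms sums_summable by blast
  have "f = (\<lambda>w. \<Sum>n. a n * w ^ n)"
    using assms by (auto simp: sums_iff)
  then have der: "(f has_field_derivative (\<Sum>n. diffs a n * z ^ n)) (at z)"
    using termdiffs_strong_converges_everywhere[of a z] summable by simp
  then show "(f has_field_derivative deriv f z) (at z)"
    using DERIV_imp_deriv by metis
  have "summable (\<lambda>n. diffs a n * z ^ n)"
    by (rule termdiff_converges_all) (rule summable)
  then show "(\<lambda>n. of_nat (Suc n) * a (Suc n) * z ^ n) sums deriv f z"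
    using DERIV_imp_deriv[OF der] by (simp add: sums_iff diffs_def)
qed

text \<open>For \<open>q < 1\<close> the difference quotient multiplies \<open>z ^ n\<close> by
  \<open>(1 - q ^ n) / ((1 - q) * z)\<close>, which is \<open>q_number q n / z\<close>; for
  \<open>q = 1\<close> this is termwise differentiation.\<close>

lemma R_op_sums:
  assumes q: "0 \<le> q" "q \<le> 1"
    and sums: "\<And>z. z \<in> F2q_domain q \<Longrightarrow> (\<lambda>n. a n * z ^ n) sums f z"
    and z: "z \<in> F2q_domain q"
  shows "(\<lambda>n. complex_of_real (q_number q (Suc n)) * a (Suc n) * z ^ n) sums R_op q f z"
proof -
  have coeff: "taylor_coeff f = a"
    using sums by (rule taylor_coeff_power_series)
  consider "q = 1" | "q \<noteq> 1" "z = 0" | "q \<noteq> 1" "z \<noteq> 0"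
    by blast
  then show ?thesis
  proof cases
    case 1
    then have "(\<lambda>n. of_nat (Suc n) * a (Suc n) * z ^ n) sums deriv f z"
      using sums by (intro entire_power_series_deriv) (simp add: F2q_domain_1)
    then show ?thesis
      using 1 z by (simp add: R_op_def q_number_1 del: of_nat_Suc)
  next
    case 2
    \<comment> \<open>At \<open>z = 0\<close> only the term of index 0 survives, and
      \<open>q_number q 1\<close> is 1.\<close>
    have "deriv f 0 = a 1"
      using fun_cong[OF coeff, of 1] by (simp add: taylor_coeff_def)
    then show ?thesis
      using 2 z by (simp add: R_op_def q_number_def)
  next
    case 3
    let ?c = "complex_of_real (1 - q) * z"
    have c: "?c \<noteq> 0"
      using 3 by simp
    have qz: "complex_of_real q * z \<in> F2q_domain q"
      using q z by (intro F2q_domain_mult) auto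
    have "(\<lambda>n. a n * z ^ n - a n * (complex_of_real q * z) ^ n) sums
        (f z - f (complex_of_real q * z))"
      by (intro sums_diff sums z qz)
    \<comment> \<open>The constant terms cancel, so every remaining term is divisible by
      \<open>z\<close>.\<close>
    then have "(\<lambda>n. a (Suc n) * z ^ Suc n - a (Suc n) * (complex_of_real q * z) ^ Suc n) sums
        (f z - f (complex_of_real q * z))"
      by (subst sums_Suc_iff) simp
    then have "(\<lambda>n. (a (Suc n) * z ^ Suc n - a (Suc n) * (complex_of_real q * z) ^ Suc n) / ?c) sums
        ((f z - f (complex_of_real q * z)) / ?c)"
      by (rule sums_divide)
    moreover have "(a (Suc n) * z ^ Suc n - a (Suc n) * (complex_of_real q * z) ^ Suc n) / ?c =
        complex_of_real (q_number q (Suc n)) * a (Suc n) * z ^ n" for n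
    proof -
      have "complex_of_real (1 - q) * complex_of_real (q_number q (Suc n)) =
          1 - complex_of_real q ^ Suc n"
        by (metis of_real_1 of_real_diff of_real_mult of_real_power q_number_mult)
      then have "complex_of_real (q_number q (Suc n)) * a (Suc n) * z ^ n * ?c =
          (1 - complex_of_real q ^ Suc n) * a (Suc n) * z ^ Suc n"
        by (metis (no_types, opaque_lifting) mult.assoc mult.commute power_Suc)
      then show ?thesis
        using c by (simp only: nonzero_divide_eq_eq[OF c] power_mult_distrib) (simp add: algebra_simps)
    qed
    ultimately show ?thesis
      using 3 z by (simp add: R_op_def)
  qed
qed

text \<open>The new factor \<open>q_number q (Suc n)\<close> turns the weight
  \<open>q_fact q n\<close> into \<open>q_fact q (Suc n)\<close>, so the norm series of
  \<open>R_op q f\<close> is that of \<open>f\<close> without its first term.\<close>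

lemma R_op_in_F2q:
  assumes q: "0 \<le> q" "q \<le> 1" and f: "f \<in> F2q q"
  shows "R_op q f \<in> F2q q"
    and "taylor_coeff (R_op q f) n = complex_of_real (q_number q (Suc n)) * taylor_coeff f (Suc n)"
proof -
  note sums = R_op_sums[OF q F2qD(2)[OF f]]
  show "taylor_coeff (R_op q f) n = complex_of_real (q_number q (Suc n)) * taylor_coeff f (Suc n)"
    by (subst taylor_coeff_power_series[OF sums]) auto
  have "summable (\<lambda>n. (norm (taylor_coeff f (Suc n)))\<^sup>2 * (q_fact q (Suc n))\<^sup>2)"
    using F2qD(3)[OF f] by (subst summable_Suc_iff)
  then have "summable (\<lambda>n. (norm (complex_of_real (q_number q (Suc n)) * taylor_coeff f (Suc n)))\<^sup>2
      * (q_fact q n)\<^sup>2)"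
    by (simp add: q_fact_Suc norm_mult power_mult_distrib mult_ac)
  moreover have "R_op q f \<in> extensional (F2q_domain q)"
    unfolding R_op_def by (rule restrict_extensional)
  ultimately show "R_op q f \<in> F2q q"
    by (intro F2qI[OF _ sums])
qed

section \<open>Antiderivatives and the integration operator\<close>

lemma ex_R_op_antiderivative:
  assumes q: "0 \<le> q" "q \<le> 1" and g: "g \<in> F2q q"
  obtains G where "G \<in> F2q q" "R_op q G = g" "taylor_coeff G 0 = 0"
    "\<And>n. taylor_coeff G (Suc n) = taylor_coeff g n / complex_of_real (q_number q (Suc n))"
proof -
  define b where "b = taylor_coeff g"
  define a where "a = (\<lambda>n. case n of 0 \<Rightarrow> 0 | Suc m \<Rightarrow> b m / complex_of_real (q_number q (Suc m)))"
  define G where "G = (\<lambda>z\<in>F2q_domain q. \<Sum>n. a n * z ^ n)"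
  have pos: "q_number q (Suc n) > 0" for n
    using q by (intro q_number_pos)
  have "summable (\<lambda>n. a n * z ^ n)" if z: "z \<in> F2q_domain q" for z
  proof -
    \<comment> \<open>The domain is open, so \<open>z\<close> can be pushed outward to
      \<open>t * z\<close> with \<open>t > 1\<close>. Convergence of the series of \<open>g\<close>
      there gives absolute convergence at \<open>z\<close>.\<close>
    have "\<forall>\<^sub>F t in at_right 1. complex_of_real t * z \<in> F2q_domain q"
    proof -
      have "((\<lambda>t. complex_of_real t * z) \<longlongrightarrow> complex_of_real 1 * z) (at_right 1)"
        by (intro tendsto_intros)
      then show ?thesis
        using z by (intro topological_tendstoD[OF _ open_F2q_domain]) auto
    qed
    moreover have "\<forall>\<^sub>F t in at_right (1::real). t > 1"
      by (rule eventually_at_right_less)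
    ultimately have "\<forall>\<^sub>F t in at_right (1::real). complex_of_real t * z \<in> F2q_domain q \<and> t > 1"
      by eventually_elim auto
    then obtain t :: real where t: "complex_of_real t * z \<in> F2q_domain q" "t > 1"
      using eventually_happens[of _ "at_right (1::real)"] by auto
    have "summable (\<lambda>n. norm (b n * z ^ n))"
    proof (cases "z = 0")
      case True
      then show ?thesis by (simp add: norm_mult norm_power)
    next
      case False
      then have "norm z < norm (complex_of_real t * z)"
        using t(2) by (simp add: norm_mult)
      then show ?thesis
        using F2qD(2)[OF g t(1)] unfolding b_def
        by (intro powser_insidea) (auto simp: sums_iff)
    qed
    then have "summable (\<lambda>n. norm z * norm (b n * z ^ n))"
      by (rule summable_mult)
    then have "summable (\<lambda>n. a (Suc n) * z ^ Suc n)"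
    proof (rule summable_comparison_test'[where N = 0])
      fix n
      \<comment> \<open>Dividing by a q-number that is at least 1 does not increase the
        terms.\<close>
      have "norm (b n) / q_number q (Suc n) \<le> norm (b n)"
        using q_number_ge_1[OF q(1), of n] by (simp add: divide_le_eq mult_le_cancel_left1)
      then have "norm (b n) / q_number q (Suc n) * norm z ^ Suc n \<le> norm (b n) * norm z ^ Suc n"
        by (rule mult_right_mono) simp
      then show "norm (a (Suc n) * z ^ Suc n) \<le> norm z * norm (b n * z ^ n)"
        using pos[of n] by (simp add: a_def norm_mult norm_divide norm_power mult_ac)
    qed
    then show ?thesis
      by (subst (asm) summable_Suc_iff)
  qed
  then have sums: "(\<lambda>n. a n * z ^ n) sums G z" if "z \<in> F2q_domain q" for z
    using that by (simp add: G_def summable_sums)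
  have coeff: "taylor_coeff G = a"
    using sums by (rule taylor_coeff_power_series)
  have "summable (\<lambda>n. (norm (b n))\<^sup>2 * (q_fact q n)\<^sup>2)"
    using F2qD(3)[OF g] by (simp add: b_def)
  \<comment> \<open>The denominator of \<open>a (Suc n)\<close> cancels the extra factor of
    \<open>q_fact q (Suc n)\<close>: the forward shift preserves the norm.\<close>
  moreover have "(norm (a (Suc n)))\<^sup>2 * (q_fact q (Suc n))\<^sup>2 = (norm (b n))\<^sup>2 * (q_fact q n)\<^sup>2" for n
    using pos[of n] by (simp add: a_def q_fact_Suc norm_divide power_divide power_mult_distrib)
  ultimately have "summable (\<lambda>n. (norm (a (Suc n)))\<^sup>2 * (q_fact q (Suc n))\<^sup>2)"
    by simp
  then have "summable (\<lambda>n. (norm (a n))\<^sup>2 * (q_fact q n)\<^sup>2)"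
    by (subst (asm) summable_Suc_iff)
  then have G: "G \<in> F2q q"
    using sums by (intro F2qI) (auto simp: G_def)
  have coeff_Suc: "taylor_coeff G (Suc n) = taylor_coeff g n / complex_of_real (q_number q (Suc n))" for n
    by (simp add: coeff a_def b_def)
  have "taylor_coeff (R_op q G) = taylor_coeff g"
  proof
    fix n
    show "taylor_coeff (R_op q G) n = taylor_coeff g n"
      using pos[of n] by (simp add: R_op_in_F2q(2)[OF q G] coeff_Suc)
  qed
  then have "R_op q G = g"
    by (intro F2q_eqI[OF R_op_in_F2q(1)[OF q G] g])
  moreover have "taylor_coeff G 0 = 0"
    by (simp add: coeff a_def)
  ultimately show thesis
    using that G coeff_Suc by blast
qed

lemma integration_op_R_op:
  assumes q: "0 \<le> q" "q \<le> 1" and G: "G \<in> F2q q" "taylor_coeff G 0 = 0"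
  shows "integration_op q (R_op q G) = G"
proof (rule extensionalityI[OF _ F2qD(1)[OF G(1)]])
  show "integration_op q (R_op q G) \<in> extensional (F2q_domain q)"
    by (simp add: integration_op_def)
  have G0: "G 0 = 0"
    using G(2) by (simp add: taylor_coeff_def)
  fix z assume z: "z \<in> F2q_domain q"
  show "integration_op q (R_op q G) z = G z"
  proof (cases "q = 1")
    case True
    have "(\<lambda>n. taylor_coeff G n * w ^ n) sums G w" for w
      using F2qD(2)[OF G(1)] True by (simp add: F2q_domain_1)
    then have "(G has_field_derivative deriv G w) (at w)" for w
      by (rule entire_power_series_deriv)
    \<comment> \<open>\<open>G\<close> is a primitive of \<open>deriv G\<close> on the whole plane,
      so only the endpoints matter.\<close>
    then have "(deriv G has_contour_integral (G z - G 0)) (linepath 0 z)"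
      using contour_integral_primitive[of UNIV G "deriv G" "linepath 0 z"] by simp
    moreover have "R_op q G = deriv G"
      using True by (simp add: R_op_def F2q_domain_1 restrict_UNIV)
    ultimately show ?thesis
      using True z G0 by (simp add: integration_op_def contour_integral_unique)
  next
    case False
    let ?w = "\<lambda>k. complex_of_real q ^ k * z"
    have "norm (complex_of_real q) < 1"
      using q False by simp
    \<comment> \<open>As \<open>q < 1\<close>, the points \<open>?w k\<close> tend to 0; continuity
      of \<open>G\<close> and \<open>G 0 = 0\<close> make the remainder of the telescoping sum
      vanish, leaving \<open>G z\<close>.\<close>
    then have "?w \<longlonglongrightarrow> 0 * z"
      by (intro tendsto_intros LIMSEQ_power_zero)
    moreover have "isCont G 0"
      using has_fps_expansion_imp_continuous[OF
        power_series_has_fps_expansion[OF open_F2q_domain F2q_domain_zero F2qD(2)[OF G(1)]]] .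
    ultimately have "(\<lambda>k. G (?w k)) \<longlonglongrightarrow> 0"
      using isCont_tendsto_compose[of 0 G ?w] G0 by simp
    from telescope_sums'[OF this]
    have "(\<lambda>k. G (?w k) - G (?w (Suc k))) sums G z"
      by simp
    moreover have "G (?w k) - G (?w (Suc k)) =
        complex_of_real (1 - q) * z * (complex_of_real q ^ k * R_op q G (?w k))" for k
    proof -
      have "norm (complex_of_real q ^ k) \<le> 1"
        using q by (simp add: norm_power power_le_one)
      then have "?w k \<in> F2q_domain q"
        using q z by (intro F2q_domain_mult) auto
      \<comment> \<open>The form without division includes \<open>w = 0\<close>, where both sides
        are 0.\<close>
      moreover have "G w - G (complex_of_real q * w) = complex_of_real (1 - q) * w * R_op q G w"
        if "w \<in> F2q_domain q" for w
        using False that by (cases "w = 0") (simp_all add: R_op_def)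
      ultimately have "G (?w k) - G (complex_of_real q * ?w k) =
          complex_of_real (1 - q) * ?w k * R_op q G (?w k)"
        by blast
      then show ?thesis
        by (simp add: mult_ac)
    qed
    ultimately have sums: "(\<lambda>k. complex_of_real (1 - q) * z *
        (complex_of_real q ^ k * R_op q G (?w k))) sums G z"
      by simp
    show ?thesis
    \<comment> \<open>Recovering the Jackson series requires cancelling the factor
      \<open>(1 - q) * z\<close>; at \<open>z = 0\<close> both sides vanish.\<close>
    proof (cases "z = 0")
      case True
      then show ?thesis
        using z G0 False by (simp add: integration_op_def)
    next
      case z0: False
      have c: "complex_of_real (1 - q) * z \<noteq> 0"
        using False z0 by simp
      have "(\<lambda>k. complex_of_real q ^ k * R_op q G (?w k)) sums (G z / (complex_of_real (1 - q) * z))"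
        using sums_divide[OF sums, of "complex_of_real (1 - q) * z"] c by simp
      then show ?thesis
        using z False c unfolding integration_op_def by (simp add: sums_iff)
    qed
  qed
qed

text \<open>All three facts are transferred from the antiderivative of \<open>g\<close> with zero
  constant term, which coincides with the integral.\<close>

lemma integration_op_in_F2q:
  assumes q: "0 \<le> q" "q \<le> 1" and g: "g \<in> F2q q"
  shows "integration_op q g \<in> F2q q"
    and "taylor_coeff (integration_op q g) 0 = 0"
    and "taylor_coeff (integration_op q g) (Suc n) =
      taylor_coeff g n / complex_of_real (q_number q (Suc n))"
proof -
  obtain G where G: "G \<in> F2q q" "R_op q G = g" "taylor_coeff G 0 = 0"
    "\<And>n. taylor_coeff G (Suc n) = taylor_coeff g n / complex_of_real (q_number q (Suc n))"
    using ex_R_op_antiderivative[OF q g] by blast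
  have "integration_op q g = G"
    using integration_op_R_op[OF q G(1,3)] G(2) by simp
  then show "integration_op q g \<in> F2q q"
    and "taylor_coeff (integration_op q g) 0 = 0"
    and "taylor_coeff (integration_op q g) (Suc n) =
      taylor_coeff g n / complex_of_real (q_number q (Suc n))"
    using G by simp_all
qed

text \<open>The two series have the same partial sums up to an index shift, so that even without knowing
  that they converge, the values of \<open>suminf\<close> agree.\<close>

lemma F2q_inner_R_op:
  assumes q: "0 \<le> q" "q \<le> 1" and f: "f \<in> F2q q" and g: "g \<in> F2q q"
  shows "F2q_inner q (R_op q f) g = F2q_inner q f (integration_op q g)"
proof -
  let ?t = "\<lambda>n. taylor_coeff f n * cnj (taylor_coeff (integration_op q g) n) *
    complex_of_real ((q_fact q n)\<^sup>2)"
  \<comment> \<open>Of the two factors \<open>q_number q (Suc n)\<close> in the weight of degree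
    \<open>Suc n\<close>, one cancels the denominator from the integral and the other is the factor
    produced by \<open>R_op\<close>.\<close>
  have "taylor_coeff (R_op q f) n * cnj (taylor_coeff g n) * complex_of_real ((q_fact q n)\<^sup>2) =
      ?t (Suc n)" for n
    using q_number_pos[OF q(1), of n]
    by (simp add: R_op_in_F2q(2)[OF q f] integration_op_in_F2q(3)[OF q g] q_fact_Suc
        power2_eq_square)
  moreover have "(\<lambda>n. ?t (Suc n)) sums s \<longleftrightarrow> ?t sums s" for s
    by (subst sums_Suc_iff) (simp add: integration_op_in_F2q(2)[OF q g])
  ultimately show ?thesis
    by (simp add: F2q_inner_def suminf_def)
qed

section \<open>Uniqueness of the adjoint\<close>

lemma monomial_in_F2q:
  shows "(\<lambda>z\<in>F2q_domain q. z ^ n) \<in> F2q q"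
    and "taylor_coeff (\<lambda>z\<in>F2q_domain q. z ^ n) = (\<lambda>m. if m = n then 1 else 0)"
proof -
  let ?a = "\<lambda>m. if m = n then 1 else 0 :: complex"
  have sums: "(\<lambda>m. ?a m * z ^ m) sums (\<lambda>z\<in>F2q_domain q. z ^ n) z" if "z \<in> F2q_domain q" for z
    using sums_single[of n "\<lambda>m. z ^ m"] that by (simp add: if_distrib[of "\<lambda>x. x * _"] cong: if_cong)
  show "taylor_coeff (\<lambda>z\<in>F2q_domain q. z ^ n) = ?a"
    using sums by (rule taylor_coeff_power_series)
  have "summable (\<lambda>m. (norm (?a m))\<^sup>2 * (q_fact q m)\<^sup>2)"
    by (rule summable_finite[of "{n}"]) auto
  then show "(\<lambda>z\<in>F2q_domain q. z ^ n) \<in> F2q q"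
    using sums by (intro F2qI) auto
qed

lemma F2q_inner_monomial:
  "F2q_inner q (\<lambda>z\<in>F2q_domain q. z ^ n) h =
    cnj (taylor_coeff h n) * complex_of_real ((q_fact q n)\<^sup>2)"
proof -
  have "F2q_inner q (\<lambda>z\<in>F2q_domain q. z ^ n) h =
      (\<Sum>m\<in>{n}. (if m = n then 1 else 0) * cnj (taylor_coeff h m) * complex_of_real ((q_fact q m)\<^sup>2))"
    unfolding F2q_inner_def monomial_in_F2q(2) by (rule suminf_finite) auto
  then show ?thesis
    by simp
qed

text \<open>Pairing with the monomial of degree \<open>n\<close> isolates the conjugate of the
  \<open>n\<close>-th coefficient times a positive weight. This gives the uniqueness that
  \<open>THE\<close> in \<open>adjoint_on\<close> requires.\<close>

lemma F2q_inner_nondegenerate: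
  assumes q: "0 \<le> q" and "h \<in> F2q q" "h' \<in> F2q q"
    and inner: "\<And>f. f \<in> F2q q \<Longrightarrow> F2q_inner q f h = F2q_inner q f h'"
  shows "h = h'"
proof (rule F2q_eqI[OF assms(2,3)], rule ext)
  fix n
  show "taylor_coeff h n = taylor_coeff h' n"
    using inner[OF monomial_in_F2q(1)[of n q]] q_fact_pos[OF q, of n]
    by (simp add: F2q_inner_monomial)
qed

theorem proposition4p7:
  fixes q :: real
  assumes "0 \<le> q" and "q \<le> 1"
  shows "R_op q \<in> F2q q \<rightarrow> F2q q \<and>
         integration_op q \<in> F2q q \<rightarrow> F2q q \<and>
         (\<forall>g\<in>F2q q. adjoint_on (F2q q) (F2q_inner q) (R_op q) g = integration_op q g)"
proof (intro conjI ballI)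
  show "R_op q \<in> F2q q \<rightarrow> F2q q"
    using R_op_in_F2q(1)[OF assms] by blast
  show "integration_op q \<in> F2q q \<rightarrow> F2q q"
    using integration_op_in_F2q(1)[OF assms] by blast
  fix g assume g: "g \<in> F2q q"
  show "adjoint_on (F2q q) (F2q_inner q) (R_op q) g = integration_op q g"
    unfolding adjoint_on_def
  proof (rule the_equality)
    show "integration_op q g \<in> F2q q \<and>
        (\<forall>f\<in>F2q q. F2q_inner q (R_op q f) g = F2q_inner q f (integration_op q g))"
      using integration_op_in_F2q(1)[OF assms g] F2q_inner_R_op[OF assms _ g] by blast
  next
    fix h assume h: "h \<in> F2q q \<and> (\<forall>f\<in>F2q q. F2q_inner q (R_op q f) g = F2q_inner q f h)"
    show "h = integration_op q g"
    proof (rule F2q_inner_nondegenerate[OF assms(1)])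
      show "h \<in> F2q q" "integration_op q g \<in> F2q q"
        using h integration_op_in_F2q(1)[OF assms g] by auto
      show "F2q_inner q f h = F2q_inner q f (integration_op q g)" if "f \<in> F2q q" for f
        using h that F2q_inner_R_op[OF assms that g] by metis
    qed
  qed
qed

end
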